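(* Let $p$ be a prime and let $m=p^r$ with $r$ a positive integer. For each $n\ge 0$, let $p_m(n)$ be the probability that a permutation of $\{1,\dots,n\}$ chosen uniformly at random has an $m$th root. Then for all integers $j\ge 0$, $$p_m(jp)=p_m(jp+1)=\cdots=p_m(jp+(p-1)).$$
   Context: $S_n$ is the group of permutations of $\{1,\dots,n\}$. A permutation $\sigma\in S_n$ has an $m$th root if there exists $\tau\in S_n$ with $\tau^m=\sigma$. Thus $p_m(n)=\frac{1}{n!}\,|\{\sigma\in S_n:\exists\,\tau\in S_n,\ \tau^m=\sigma\}|$. For $n=0$, $S_0$ is the trivial group and $p_m(0)=1$. *)

theory Defs
  imports
    Complex_Main
    "HOL-Combinatorics.Permutations"
    "HOL-Computational_Algebra.Primes"
begin

(* A member of the symmetric group of {1..n} is a function on nat that permutes {1..n}, hence is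
   the identity elsewhere; the group operation is composition, so the m-th power is the iterate. *)
definition has_mth_root :: "nat \<Rightarrow> nat \<Rightarrow> (nat \<Rightarrow> nat) \<Rightarrow> bool" where
  "has_mth_root m n \<sigma> \<longleftrightarrow> (\<exists>\<tau>. \<tau> permutes {1..n} \<and> \<tau> ^^ m = \<sigma>)"

definition root_prob :: "nat \<Rightarrow> nat \<Rightarrow> real" where
  "root_prob m n =
     real (card {\<sigma>. \<sigma> permutes {1..n} \<and> has_mth_root m n \<sigma>}) / fact n"

end

theory Submission
  imports Defs "HOL-Combinatorics.Orbits" "HOL-Combinatorics.Cycles" "HOL-Number_Theory.Cong"
begin

text \<open>Split a permutation into its \<open>p\<close>-singular part (the points on cycles of length divisible by
  \<open>p\<close>) and its \<open>p\<close>-regular part. The regular part has order coprime to \<open>p\<close>, hence always has a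
  \<open>p ^ r\<close>-th root, so the permutation has one iff its singular part does. Counting by the singular
  set gives \<open>p\<^sub>m(n) = (\<Sum>k\<le>n. b\<^sub>m(k) * a(n - k))\<close>, where \<open>a\<close> is the proportion of regular
  permutations and \<open>b\<^sub>m(k) = 0\<close> unless \<open>p\<close> divides \<open>k\<close>. For \<open>m = p ^ 0\<close> the left side is 1, which
  forces \<open>a(j * p + i) = a(j * p)\<close> by induction on \<open>j\<close>; the convolution for general \<open>m\<close> then
  inherits the periodicity.\<close>

text \<open>Roots over an arbitrary carrier, because the two factors of a permutation live on a
  subset and on its complement.\<close>

definition has_root_on :: "nat \<Rightarrow> 'a set \<Rightarrow> ('a \<Rightarrow> 'a) \<Rightarrow> bool" where
  "has_root_on m S \<sigma> \<longleftrightarrow> (\<exists>\<tau>. \<tau> permutes S \<and> \<tau> ^^ m = \<sigma>)"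

text \<open>For a permutation of a finite set, the \<open>k\<close> returning \<open>x\<close> to
  itself are the multiples of its cycle length, so divisibility of all of them encodes divisibility
  of that length; \<open>k = 0\<close> imposes nothing.\<close>

definition p_singular :: "nat \<Rightarrow> ('a \<Rightarrow> 'a) \<Rightarrow> 'a set" where
  "p_singular p f = {x. \<forall>k. (f ^^ k) x = x \<longrightarrow> p dvd k}"

definition singular_rooted :: "nat \<Rightarrow> nat \<Rightarrow> 'a set \<Rightarrow> ('a \<Rightarrow> 'a) set" where
  "singular_rooted p m U = {\<beta>. \<beta> permutes U \<and> p_singular p \<beta> = U \<and> has_root_on m U \<beta>}"

definition regular_perms :: "nat \<Rightarrow> 'a set \<Rightarrow> ('a \<Rightarrow> 'a) set" where
  "regular_perms p V = {\<alpha>. \<alpha> permutes V \<and> p_singular p \<alpha> = {}}"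

section \<open>Powers of commuting permutations and of disjoint ones\<close>

lemma commute_funpow:
  assumes "f \<circ> g = g \<circ> f"
  shows "f \<circ> g ^^ n = g ^^ n \<circ> f"
proof
  fix x
  have "f (g y) = g (f y)" for y using fun_cong[OF assms, of y] by simp
  thus "(f \<circ> g ^^ n) x = (g ^^ n \<circ> f) x" by (induction n) simp_all
qed

lemma funpow_comp_commute:
  assumes "f \<circ> g = g \<circ> f"
  shows "(f \<circ> g) ^^ n = f ^^ n \<circ> g ^^ n"
proof
  fix x
  have "g ((f ^^ k) y) = (f ^^ k) (g y)" for k y
    using fun_cong[OF commute_funpow[OF assms[symmetric], of k], of y] by simp
  thus "((f \<circ> g) ^^ n) x = (f ^^ n \<circ> g ^^ n) x" by (induction n) simp_all
qed

lemma permutes_disjoint_commute: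
  assumes "f permutes U" "g permutes V" "U \<inter> V = {}"
  shows "f \<circ> g = g \<circ> f"
proof
  fix x
  have "f y = y" if "y \<in> V" for y
    using that assms(3) permutes_not_in[OF assms(1)] by blast
  moreover have "g y = y" if "y \<in> U" for y
    using that assms(3) permutes_not_in[OF assms(2)] by blast
  ultimately show "(f \<circ> g) x = (g \<circ> f) x"
    using permutes_in_image[OF assms(1), of x] permutes_in_image[OF assms(2), of x]
      permutes_not_in[OF assms(1), of x] permutes_not_in[OF assms(2), of x]
    by (cases "x \<in> U"; cases "x \<in> V") simp_all
qed

lemma funpow_comp_disjoint:
  assumes "f permutes U" "g permutes V" "U \<inter> V = {}"
  shows "((f \<circ> g) ^^ k) x = (if x \<in> U then (f ^^ k) x else (g ^^ k) x)"
proof (cases "x \<in> U")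
  case True
  hence "x \<notin> V" using assms(3) by blast
  hence "(g ^^ k) x = x" by (rule permutes_not_in[OF permutes_funpow[OF assms(2)]])
  thus ?thesis
    using True funpow_comp_commute[OF permutes_disjoint_commute[OF assms], of k] by simp
next
  case False
  hence "(f ^^ k) x = x" by (rule permutes_not_in[OF permutes_funpow[OF assms(1)]])
  \<comment> \<open>In this order \<open>f ^^ k\<close> acts first, on a point that it
    fixes.\<close>
  moreover have "(f \<circ> g) ^^ k = g ^^ k \<circ> f ^^ k"
    unfolding permutes_disjoint_commute[OF assms]
    by (rule funpow_comp_commute) (rule permutes_disjoint_commute[OF assms, symmetric])
  ultimately show ?thesis using False by simp
qed

section \<open>Singular sets and restriction to invariant sets\<close>

lemma p_singular_comp_disjoint:
  assumes "\<beta> permutes U" "\<alpha> permutes V" "U \<inter> V = {}" "p_singular p \<alpha> = {}"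
  shows "p_singular p (\<beta> \<circ> \<alpha>) = p_singular p \<beta> \<inter> U"
proof -
  \<comment> \<open>A point has the same return times under the composite as under the factor
    responsible for it.\<close>
  have "x \<in> p_singular p (\<beta> \<circ> \<alpha>) \<longleftrightarrow> x \<in> (if x \<in> U then p_singular p \<beta> else p_singular p \<alpha>)" for x
    by (simp add: p_singular_def funpow_comp_disjoint[OF assms(1-3)])
  with assms(4) show ?thesis by (auto split: if_splits)
qed

lemma p_singular_subset:
  assumes "\<sigma> permutes S" "p \<noteq> 1"
  shows "p_singular p \<sigma> \<subseteq> S"
proof
  fix x assume x: "x \<in> p_singular p \<sigma>"
  show "x \<in> S"
  proof (rule ccontr)
    assume "x \<notin> S"
    hence "(\<sigma> ^^ 1) x = x" using assms by (simp add: permutes_not_in)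
    hence "p dvd 1" using x unfolding p_singular_def by blast
    thus False using assms by simp
  qed
qed

text \<open>Since \<tau> is injective and commutes with the powers of \<sigma>, the points
  \<open>x\<close> and \<open>\<tau> x\<close> have the same return times under \<sigma>. Hence
  every root of \<sigma>, and \<sigma> itself, preserves the singular set.\<close>

lemma commute_p_singular:
  assumes "inj \<tau>" "\<tau> \<circ> \<sigma> = \<sigma> \<circ> \<tau>"
  shows "\<tau> x \<in> p_singular p \<sigma> \<longleftrightarrow> x \<in> p_singular p \<sigma>"
proof -
  have "(\<sigma> ^^ k) (\<tau> x) = \<tau> ((\<sigma> ^^ k) x)" for k
    using commute_funpow[OF assms(2), of k] by (metis comp_apply)
  thus ?thesis using assms(1) by (simp add: p_singular_def inj_eq)
qed

lemma perm_restrict_permutes: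
  assumes "finite U" "inj \<tau>" "\<tau> ` U \<subseteq> U"
  shows "perm_restrict \<tau> U permutes U"
proof (rule bij_imp_permutes)
  have "inj_on \<tau> U" using assms(2) by (rule inj_on_subset) simp
  \<comment> \<open>Finiteness turns the inclusion of the image into equality.\<close>
  hence "bij_betw \<tau> U U" using endo_inj_surj[OF assms(1,3)] by (simp add: bij_betw_def)
  thus "bij_betw (perm_restrict \<tau> U) U U"
    by (rule bij_betw_cong[THEN iffD1, rotated]) (simp add: perm_restrict_simps)
qed (simp add: perm_restrict_simps)

lemma funpow_perm_restrict:
  assumes "\<tau> ` U \<subseteq> U" "x \<in> U"
  shows "(perm_restrict \<tau> U ^^ k) x = (\<tau> ^^ k) x"
proof -
  have "(perm_restrict \<tau> U ^^ k) x = (\<tau> ^^ k) x \<and> (\<tau> ^^ k) x \<in> U"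
    using assms by (induction k) (auto simp: perm_restrict_simps)
  thus ?thesis ..
qed

section \<open>Roots of the regular and the singular factor\<close>

lemma regular_has_root:
  assumes "prime p" "finite V" "\<alpha> \<in> regular_perms p V"
  shows "has_root_on (p ^ r) V \<alpha>"
proof -
  have \<alpha>: "\<alpha> permutes V" and "\<forall>x. \<exists>k. (\<alpha> ^^ k) x = x \<and> \<not> p dvd k"
    using assms(3) by (auto simp: regular_perms_def p_singular_def)
  then obtain k where k: "\<And>x. (\<alpha> ^^ k x) x = x" "\<And>x. \<not> p dvd k x" by metis
  \<comment> \<open>A common period serves in place of the order: a product of return times, none
    divisible by the prime \<open>p\<close>, is itself not divisible by \<open>p\<close>.\<close>
  define N where "N = (\<Prod>x\<in>V. k x)"
  have period: "(\<alpha> ^^ N) x = x" for x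
  proof (cases "x \<in> V")
    case True
    hence "k x dvd N" unfolding N_def by (rule dvd_prodI[OF assms(2)])
    hence "N mod k x = 0" by simp
    with funpow_mod_eq[OF k(1), of N x] show ?thesis by simp
  qed (use permutes_not_in[OF permutes_funpow[OF \<alpha>]] in auto)
  have "\<not> p dvd N" using assms k(2) by (simp add: N_def prime_dvd_prod_iff)
  hence "coprime (p ^ r) N" using assms(1) by (simp add: prime_imp_coprime)
  then obtain s where s: "[p ^ r * s = 1] (mod N)" using cong_solve_coprime_nat[of "p ^ r" N] by auto
  \<comment> \<open>Exponents matter only modulo \<open>N\<close>, where \<open>s\<close> inverts
    \<open>p ^ r\<close>; so \<open>\<alpha> ^^ s\<close> is the root.\<close>
  have "(\<alpha> ^^ (s * p ^ r)) x = \<alpha> x" for x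
    using funpow_mod_eq[OF period, of "s * p ^ r" x] funpow_mod_eq[OF period, of 1 x] s
    by (simp add: cong_def mult.commute)
  hence "(\<alpha> ^^ s) ^^ (p ^ r) = \<alpha>" by (auto simp: funpow_mult)
  thus ?thesis unfolding has_root_on_def using permutes_funpow[OF \<alpha>] by blast
qed

text \<open>A root of the composite commutes with it, hence preserves its singular set
  \<open>U\<close> and restricts there to a root of \<beta>. Conversely, a root of \<beta> is
  composed with the root of \<alpha> that regularity provides; these have disjoint supports, so
  their powers multiply.\<close>

lemma has_root_on_comp_iff:
  assumes "prime p" "finite S" "U \<subseteq> S" "\<beta> permutes U" "p_singular p \<beta> = U"
    and \<alpha>: "\<alpha> \<in> regular_perms p (S - U)"
  shows "has_root_on (p ^ r) S (\<beta> \<circ> \<alpha>) \<longleftrightarrow> has_root_on (p ^ r) U \<beta>"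
proof
  have \<alpha>p: "\<alpha> permutes S - U" and \<alpha>r: "p_singular p \<alpha> = {}"
    using \<alpha> by (auto simp: regular_perms_def)
  have sing: "p_singular p (\<beta> \<circ> \<alpha>) = U"
    using p_singular_comp_disjoint[OF assms(4) \<alpha>p _ \<alpha>r] assms(5) by auto
  {
    assume "has_root_on (p ^ r) S (\<beta> \<circ> \<alpha>)"
    then obtain \<tau> where \<tau>: "\<tau> permutes S" "\<tau> ^^ (p ^ r) = \<beta> \<circ> \<alpha>" by (auto simp: has_root_on_def)
    have comm: "\<tau> \<circ> (\<beta> \<circ> \<alpha>) = (\<beta> \<circ> \<alpha>) \<circ> \<tau>"
      using commute_funpow[of \<tau> \<tau> "p ^ r"] \<tau>(2) by simp
    have inj: "inj \<tau>" using \<tau>(1) by (rule permutes_inj)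
    have U: "\<tau> ` U \<subseteq> U" using commute_p_singular[OF inj comm, of _ p] sing by auto
    have fin: "finite U" using assms finite_subset by blast
    define \<rho> where "\<rho> = perm_restrict \<tau> U"
    have \<rho>: "\<rho> permutes U" unfolding \<rho>_def by (rule perm_restrict_permutes[OF fin inj U])
    have "(\<rho> ^^ (p ^ r)) x = \<beta> x" for x
    proof (cases "x \<in> U")
      case True
      hence "(\<rho> ^^ (p ^ r)) x = (\<beta> \<circ> \<alpha>) x"
        unfolding \<rho>_def by (simp only: funpow_perm_restrict[OF U] \<tau>)
      also have "\<dots> = \<beta> x" using True permutes_not_in[OF \<alpha>p, of x] by simp
      finally show ?thesis .
    next
      case False
      thus ?thesis using permutes_not_in[OF permutes_funpow[OF \<rho>]] permutes_not_in[OF assms(4)] by simp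
    qed
    thus "has_root_on (p ^ r) U \<beta>" unfolding has_root_on_def using \<rho> by blast
  }
  assume "has_root_on (p ^ r) U \<beta>"
  then obtain \<rho> where \<rho>: "\<rho> permutes U" "\<rho> ^^ (p ^ r) = \<beta>" by (auto simp: has_root_on_def)
  have "has_root_on (p ^ r) (S - U) \<alpha>" using regular_has_root assms by blast
  then obtain \<theta> where \<theta>: "\<theta> permutes S - U" "\<theta> ^^ (p ^ r) = \<alpha>" by (auto simp: has_root_on_def)
  have "(\<rho> \<circ> \<theta>) ^^ (p ^ r) = \<beta> \<circ> \<alpha>"
    using funpow_comp_commute[OF permutes_disjoint_commute[OF \<rho>(1) \<theta>(1)]] \<rho>(2) \<theta>(2) by simp
  moreover have "\<rho> \<circ> \<theta> permutes S"
    using permutes_compose[OF permutes_subset[OF \<theta>(1)] permutes_subset[OF \<rho>(1) assms(3)]] by auto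
  ultimately show "has_root_on (p ^ r) S (\<beta> \<circ> \<alpha>)" unfolding has_root_on_def by blast
qed

text \<open>The inverse map restricts \<sigma> to its singular set and to the complement. This
  reduces the count for a fixed singular set to a product.\<close>

lemma bij_betw_singular_regular:
  assumes "prime p" "finite S" "U \<subseteq> S"
  shows "bij_betw (\<lambda>(\<beta>, \<alpha>). \<beta> \<circ> \<alpha>) (singular_rooted p (p ^ r) U \<times> regular_perms p (S - U))
    {\<sigma>. \<sigma> permutes S \<and> has_root_on (p ^ r) S \<sigma> \<and> p_singular p \<sigma> = U}"
    (is "bij_betw ?c (?B \<times> ?A) ?C")
proof (rule bij_betwI[where g = "\<lambda>\<sigma>. (perm_restrict \<sigma> U, perm_restrict \<sigma> (S - U))"])
  show "?c \<in> ?B \<times> ?A \<rightarrow> ?C"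
  proof
    fix x assume "x \<in> ?B \<times> ?A"
    then obtain \<beta> \<alpha> where x: "x = (\<beta>, \<alpha>)" and "\<beta> \<in> ?B" and \<alpha>: "\<alpha> \<in> ?A" by (rule SigmaE)
    hence \<beta>: "\<beta> permutes U" "p_singular p \<beta> = U" "has_root_on (p ^ r) U \<beta>"
      and \<alpha>': "\<alpha> permutes S - U" "p_singular p \<alpha> = {}"
      by (auto simp: singular_rooted_def regular_perms_def)
    have "\<beta> \<circ> \<alpha> permutes S"
      using permutes_compose[OF permutes_subset[OF \<alpha>'(1)] permutes_subset[OF \<beta>(1) assms(3)]] by auto
    moreover have "has_root_on (p ^ r) S (\<beta> \<circ> \<alpha>)"
      using has_root_on_comp_iff[OF assms \<beta>(1,2) \<alpha>] \<beta>(3) by simp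
    moreover have "p_singular p (\<beta> \<circ> \<alpha>) = U"
      using p_singular_comp_disjoint[OF \<beta>(1) \<alpha>'(1) _ \<alpha>'(2)] \<beta>(2) by auto
    ultimately show "?c x \<in> ?C" by (simp add: x)
  qed
next
  have split: "perm_restrict \<sigma> U \<circ> perm_restrict \<sigma> (S - U) = \<sigma>"
    "perm_restrict \<sigma> U \<in> ?B" "perm_restrict \<sigma> (S - U) \<in> ?A" if "\<sigma> \<in> ?C" for \<sigma>
  proof -
    have \<sigma>: "\<sigma> permutes S" "has_root_on (p ^ r) S \<sigma>" "p_singular p \<sigma> = U" using that by auto
    have inj: "inj \<sigma>" using \<sigma>(1) by (rule permutes_inj)
    \<comment> \<open>\<sigma> commutes with itself, so both pieces are invariant.\<close>
    have mem: "\<sigma> x \<in> U \<longleftrightarrow> x \<in> U" for x using commute_p_singular[OF inj refl, of x p] \<sigma>(3) by simp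
    have U: "\<sigma> ` U \<subseteq> U" and V: "\<sigma> ` (S - U) \<subseteq> S - U"
      using mem permutes_in_image[OF \<sigma>(1)] by auto
    have fin: "finite U" "finite (S - U)" using assms finite_subset by auto
    have \<beta>: "perm_restrict \<sigma> U permutes U" and \<alpha>: "perm_restrict \<sigma> (S - U) permutes S - U"
      using perm_restrict_permutes[OF fin(1) inj U] perm_restrict_permutes[OF fin(2) inj V] by auto
    have "U \<union> S = S" using assms by auto
    thus eq: "perm_restrict \<sigma> U \<circ> perm_restrict \<sigma> (S - U) = \<sigma>"
      using perm_restrict_union[OF \<beta> \<alpha>] perm_restrict_id[OF \<sigma>(1)] by simp
    have p1: "p \<noteq> 1" using assms(1) by auto
    have "p_singular p (perm_restrict \<sigma> U) \<subseteq> U" using p_singular_subset[OF \<beta> p1] .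
    \<comment> \<open>Restriction to an invariant set leaves the return times of its points
      unchanged.\<close>
    moreover have "x \<in> p_singular p (perm_restrict \<sigma> U)" if "x \<in> U" for x
      using that \<sigma>(3) by (auto simp: p_singular_def funpow_perm_restrict[OF U])
    ultimately have sing: "p_singular p (perm_restrict \<sigma> U) = U" by auto
    have "x \<notin> p_singular p (perm_restrict \<sigma> (S - U))" if "x \<in> S - U" for x
      using that \<sigma>(3) by (auto simp: p_singular_def funpow_perm_restrict[OF V])
    with p_singular_subset[OF \<alpha> p1] show A: "perm_restrict \<sigma> (S - U) \<in> ?A"
      using \<alpha> by (auto simp: regular_perms_def)
    have "has_root_on (p ^ r) U (perm_restrict \<sigma> U)"
      using has_root_on_comp_iff[OF assms \<beta> sing A] \<sigma>(2) eq by simp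
    thus "perm_restrict \<sigma> U \<in> ?B" using \<beta> sing by (simp add: singular_rooted_def)
  qed
  show "(\<lambda>\<sigma>. (perm_restrict \<sigma> U, perm_restrict \<sigma> (S - U))) \<in> ?C \<rightarrow> ?B \<times> ?A"
    using split(2,3) by blast
  show "?c (perm_restrict \<sigma> U, perm_restrict \<sigma> (S - U)) = \<sigma>" if "\<sigma> \<in> ?C" for \<sigma>
    using split(1)[OF that] by simp
next
  fix x assume "x \<in> ?B \<times> ?A"
  then obtain \<beta> \<alpha> where x: "x = (\<beta>, \<alpha>)" and \<beta>: "\<beta> permutes U" and \<alpha>: "\<alpha> permutes S - U"
    by (auto simp: singular_rooted_def regular_perms_def)
  have comp: "(\<beta> \<circ> \<alpha>) y = (if y \<in> U then \<beta> y else \<alpha> y)" for y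
    using funpow_comp_disjoint[OF \<beta> \<alpha>, of 1 y] by auto
  have "perm_restrict (\<beta> \<circ> \<alpha>) U = \<beta>" "perm_restrict (\<beta> \<circ> \<alpha>) (S - U) = \<alpha>"
    using permutes_not_in[OF \<beta>] permutes_not_in[OF \<alpha>]
    unfolding fun_eq_iff perm_restrict_def comp by auto
  thus "(perm_restrict (?c x) U, perm_restrict (?c x) (S - U)) = x" by (simp add: x)
qed

section \<open>Relabelling by conjugation\<close>

lemma ex_bij_image_eq:
  assumes "finite U" "finite V" "card U = card V"
  obtains \<pi> :: "'a \<Rightarrow> 'a" where "bij \<pi>" "\<pi> ` U = V"
proof -
  let ?W = "U \<union> V"
  obtain f where f: "bij_betw f U V" using finite_same_card_bij[OF assms] by blast
  \<comment> \<open>\<open>U\<close> and \<open>V\<close> may overlap, so \<open>f\<close> need not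
    extend injectively by the identity; the leftovers in the union have equal size and are matched
    by \<open>g\<close>.\<close>
  have "card (?W - U) = card (?W - V)" using assms by (simp add: card_Diff_subset)
  then obtain g where g: "bij_betw g (?W - U) (?W - V)"
    using assms finite_same_card_bij[of "?W - U" "?W - V"] by auto
  have "bij_betw (\<lambda>x. if x \<in> U then f x else g x) (U \<union> (?W - U)) (V \<union> (?W - V))"
    using f g by (rule bij_betw_disjoint_Un) auto
  moreover have "U \<union> (?W - U) = ?W" "V \<union> (?W - V) = ?W" by auto
  ultimately have "bij_betw (\<lambda>x. if x \<in> U then f x else g x) ?W ?W" by simp
  \<comment> \<open>Outside the union the identity completes a bijection of the whole type, as
    conjugation with \<open>inv\<close> requires.\<close>
  hence "bij_betw (\<lambda>x. if x \<in> ?W then if x \<in> U then f x else g x else id x) (?W \<union> - ?W) (?W \<union> - ?W)"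
    by (rule bij_betw_disjoint_Un[OF _ bij_betw_id]) auto
  hence "bij (\<lambda>x. if x \<in> ?W then if x \<in> U then f x else g x else id x)"
    by (simp only: Compl_partition)
  moreover have "(\<lambda>x. if x \<in> ?W then if x \<in> U then f x else g x else id x) ` U = V"
    using f by (auto simp: bij_betw_def)
  ultimately show ?thesis by (rule that)
qed

lemma funpow_conj:
  assumes "bij \<pi>"
  shows "(\<pi> \<circ> f \<circ> inv \<pi>) ^^ k = \<pi> \<circ> f ^^ k \<circ> inv \<pi>"
proof
  fix x
  show "((\<pi> \<circ> f \<circ> inv \<pi>) ^^ k) x = (\<pi> \<circ> f ^^ k \<circ> inv \<pi>) x"
    using bij_is_inj[OF assms] bij_is_surj[OF assms]
    by (induction k) (simp_all add: inv_f_f surj_f_inv_f)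
qed

lemma permutes_conj:
  assumes "bij \<pi>" "f permutes U"
  shows "\<pi> \<circ> f \<circ> inv \<pi> permutes \<pi> ` U"
proof -
  have "bij (\<pi> \<circ> f \<circ> inv \<pi>)"
    using assms by (intro bij_comp bij_imp_bij_inv) (auto dest: permutes_bij)
  moreover have "(\<pi> \<circ> f \<circ> inv \<pi>) x = x" if "x \<notin> \<pi> ` U" for x
  proof -
    have "inv \<pi> x \<notin> U" using that surj_f_inv_f[OF bij_is_surj[OF assms(1)], of x] by force
    thus ?thesis using assms by (simp add: permutes_not_in bij_is_surj surj_f_inv_f)
  qed
  ultimately show ?thesis unfolding permutes_def bij_iff by blast
qed

lemma p_singular_conj:
  assumes "bij \<pi>"
  shows "p_singular p (\<pi> \<circ> f \<circ> inv \<pi>) = \<pi> ` p_singular p f"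
proof (rule set_eqI)
  fix x
  have inj: "inj \<pi>" using assms by (rule bij_is_inj)
  obtain y where x: "x = \<pi> y" using surjD[OF bij_is_surj[OF assms], of x] by blast
  show "x \<in> p_singular p (\<pi> \<circ> f \<circ> inv \<pi>) \<longleftrightarrow> x \<in> \<pi> ` p_singular p f"
    unfolding x inj_image_mem_iff[OF inj]
    using inj by (simp add: p_singular_def funpow_conj[OF assms] inv_f_f inj_eq)
qed

lemma singular_rooted_conj:
  assumes "bij \<pi>" "f \<in> singular_rooted p m U"
  shows "\<pi> \<circ> f \<circ> inv \<pi> \<in> singular_rooted p m (\<pi> ` U)"
proof -
  have f: "f permutes U" "p_singular p f = U" "has_root_on m U f"
    using assms(2) by (auto simp: singular_rooted_def)
  obtain \<tau> where \<tau>: "\<tau> permutes U" "\<tau> ^^ m = f" using f(3) by (auto simp: has_root_on_def)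
  have "has_root_on m (\<pi> ` U) (\<pi> \<circ> f \<circ> inv \<pi>)"
    unfolding has_root_on_def
    using permutes_conj[OF assms(1) \<tau>(1)] funpow_conj[OF assms(1), where f = \<tau> and k = m] \<tau>(2) by metis
  thus ?thesis
    using permutes_conj[OF assms(1) f(1)] p_singular_conj[OF assms(1), of p f] f(2)
    by (simp add: singular_rooted_def)
qed

lemma regular_perms_conj:
  assumes "bij \<pi>" "f \<in> regular_perms p U"
  shows "\<pi> \<circ> f \<circ> inv \<pi> \<in> regular_perms p (\<pi> ` U)"
  using assms(2) permutes_conj[OF assms(1), of f U] p_singular_conj[OF assms(1), of p f]
  by (simp add: regular_perms_def)

lemma finite_singular_rooted: "finite U \<Longrightarrow> finite (singular_rooted p m U)"
  unfolding singular_rooted_def by (rule finite_subset[OF _ finite_permutations]) auto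

lemma finite_regular_perms: "finite U \<Longrightarrow> finite (regular_perms p U)"
  unfolding regular_perms_def by (rule finite_subset[OF _ finite_permutations]) auto

lemma inj_conj:
  assumes "bij \<pi>"
  shows "inj (\<lambda>f. \<pi> \<circ> f \<circ> inv \<pi>)"
proof (intro injI ext)
  fix f g x assume "\<pi> \<circ> f \<circ> inv \<pi> = \<pi> \<circ> g \<circ> inv \<pi>"
  from fun_cong[OF this, of "\<pi> x"] show "f x = g x"
    using bij_is_inj[OF assms] by (simp add: inv_f_f inj_eq)
qed

text \<open>Conjugation by a bijection carrying \<open>U\<close> to \<open>V\<close> is injective
  and preserves cycle lengths and roots. Exchanging \<open>U\<close> and \<open>V\<close> gives the
  reverse inequality, so the count depends only on the size of the carrier.\<close>

lemma card_singular_rooted_le: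
  fixes U V :: "'a set"
  assumes "finite U" "finite V" "card U = card V"
  shows "card (singular_rooted p m U) \<le> card (singular_rooted p m V)"
proof -
  obtain \<pi> :: "'a \<Rightarrow> 'a" where \<pi>: "bij \<pi>" "\<pi> ` U = V" by (rule ex_bij_image_eq[OF assms])
  show ?thesis
  proof (rule card_inj_on_le)
    show "inj_on (\<lambda>f. \<pi> \<circ> f \<circ> inv \<pi>) (singular_rooted p m U)"
      using inj_conj[OF \<pi>(1)] by (rule inj_on_subset) simp
    show "(\<lambda>f. \<pi> \<circ> f \<circ> inv \<pi>) ` singular_rooted p m U \<subseteq> singular_rooted p m V"
      using singular_rooted_conj[OF \<pi>(1)] \<pi>(2) by blast
  qed (rule finite_singular_rooted[OF assms(2)])
qed

lemma card_regular_perms_le: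
  fixes U V :: "'a set"
  assumes "finite U" "finite V" "card U = card V"
  shows "card (regular_perms p U) \<le> card (regular_perms p V)"
proof -
  obtain \<pi> :: "'a \<Rightarrow> 'a" where \<pi>: "bij \<pi>" "\<pi> ` U = V" by (rule ex_bij_image_eq[OF assms])
  show ?thesis
  proof (rule card_inj_on_le)
    show "inj_on (\<lambda>f. \<pi> \<circ> f \<circ> inv \<pi>) (regular_perms p U)"
      using inj_conj[OF \<pi>(1)] by (rule inj_on_subset) simp
    show "(\<lambda>f. \<pi> \<circ> f \<circ> inv \<pi>) ` regular_perms p U \<subseteq> regular_perms p V"
      using regular_perms_conj[OF \<pi>(1)] \<pi>(2) by blast
  qed (rule finite_regular_perms[OF assms(2)])
qed

text \<open>\<open>U\<close> is a disjoint union of orbits, and the size of each orbit is a return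
  time of its points, hence a multiple of \<open>p\<close>.\<close>

lemma dvd_card_singular:
  assumes "finite U" "\<beta> permutes U" "p_singular p \<beta> = U"
  shows "p dvd card U"
proof -
  have perm: "permutation \<beta>" using assms permutation_permutes by blast
  have self: "x \<in> orbit \<beta> x" for x using permutation_self_in_orbit[OF perm] .
  have union: "(\<Union>x\<in>U. orbit \<beta> x) = U"
    using self permutes_orbit_subset[OF assms(2)] by blast
  have "p dvd card (orbit \<beta> x)" if "x \<in> U" for x
  proof -
    \<comment> \<open>\<open>funpow_dist1 \<beta> x x\<close> is the first positive return time; the
      iterates before it list the orbit without repetition.\<close>
    have "card (orbit \<beta> x) = funpow_dist1 \<beta> x x"
      using inj_on_funpow_dist1[OF self, of x] by (simp add: orbit_conv_funpow_dist1[OF self] card_image)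
    moreover have "(\<beta> ^^ funpow_dist1 \<beta> x x) x = x" by (rule funpow_dist1_prop[OF self])
    ultimately show ?thesis using that assms(3) by (auto simp: p_singular_def)
  qed
  moreover have "orbit \<beta> x \<inter> orbit \<beta> y = {}" if "orbit \<beta> x \<noteq> orbit \<beta> y" for x y
    using that cyclic_on_orbit[OF assms(2,1)] orbit_cyclic_eq3 by (metis disjoint_iff)
  ultimately have "p dvd card (\<Union>x\<in>U. orbit \<beta> x)"
    using assms(1) union by (intro dvd_partition) auto
  thus ?thesis by (simp only: union)
qed

section \<open>The convolution formula\<close>

definition singular_ratio :: "nat \<Rightarrow> nat \<Rightarrow> nat \<Rightarrow> real" where
  "singular_ratio p m k = card (singular_rooted p m {1..k}) / fact k"

definition regular_ratio :: "nat \<Rightarrow> nat \<Rightarrow> real" where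
  "regular_ratio p k = card (regular_perms p {1..k}) / fact k"

lemma singular_ratio_eq_0:
  assumes "\<not> p dvd k"
  shows "singular_ratio p m k = 0"
proof -
  have "singular_rooted p m {1..k} = {}"
    using assms dvd_card_singular[of "{1..k}" _ p] by (auto simp: singular_rooted_def)
  thus ?thesis by (simp add: singular_ratio_def)
qed

lemma sum_Pow_card:
  fixes f :: "nat \<Rightarrow> 'b::comm_semiring_1"
  assumes "finite S"
  shows "(\<Sum>U\<in>Pow S. f (card U)) = (\<Sum>k\<le>card S. of_nat (card S choose k) * f k)"
proof -
  have "(\<Sum>U\<in>Pow S. f (card U)) = (\<Sum>k\<le>card S. \<Sum>U | U \<in> Pow S \<and> card U = k. f (card U))"
    using assms by (intro sum.group[symmetric]) (auto intro: card_mono)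
  also have "\<dots> = (\<Sum>k\<le>card S. of_nat (card S choose k) * f k)"
    using assms by (intro sum.cong) (simp_all add: n_subsets)
  finally show ?thesis .
qed

text \<open>Permutations with a root are sorted by their singular set \<open>U\<close>. Each fiber
  is a product of two counts depending only on \<open>card U\<close>, and \<open>n choose k\<close>
  sets have size \<open>k\<close>.\<close>

lemma root_prob_convolution:
  assumes "prime p"
  shows "root_prob (p ^ r) n = (\<Sum>k\<le>n. singular_ratio p (p ^ r) k * regular_ratio p (n - k))"
proof -
  let ?S = "{1..n}"
  let ?C = "{\<sigma>. \<sigma> permutes ?S \<and> has_root_on (p ^ r) ?S \<sigma>}"
  let ?b = "\<lambda>k. card (singular_rooted p (p ^ r) {1..k})"
  let ?a = "\<lambda>k. card (regular_perms p {1..k})"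
  have fin: "finite ?C" by (rule finite_subset[OF _ finite_permutations[of ?S]]) auto
  have p1: "p \<noteq> 1" using assms by auto
  have fiber: "card {\<sigma> \<in> ?C. p_singular p \<sigma> = U} = ?b (card U) * ?a (n - card U)" if "U \<subseteq> ?S" for U
  proof -
    have fU: "finite U" using that finite_subset by blast
    have c: "card (?S - U) = n - card U" using that fU by (simp add: card_Diff_subset)
    have "card {\<sigma> \<in> ?C. p_singular p \<sigma> = U}
        = card (singular_rooted p (p ^ r) U) * card (regular_perms p (?S - U))"
      using bij_betw_same_card[OF bij_betw_singular_regular[OF assms _ that, of r]]
      by (simp add: card_cartesian_product conj_ac)
    also have "card (singular_rooted p (p ^ r) U) = ?b (card U)"
      using fU by (intro antisym card_singular_rooted_le) auto
    also have "card (regular_perms p (?S - U)) = ?a (n - card U)"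
      using c by (intro antisym card_regular_perms_le) auto
    finally show ?thesis .
  qed
  have sub: "p_singular p ` ?C \<subseteq> Pow ?S"
    using p_singular_subset[OF _ p1] by blast
  have "card ?C = (\<Sum>U\<in>Pow ?S. card {\<sigma> \<in> ?C. p_singular p \<sigma> = U})"
    using sum.group[OF fin _ sub, of "\<lambda>_. 1::nat"] by simp
  also have "\<dots> = (\<Sum>U\<in>Pow ?S. ?b (card U) * ?a (n - card U))"
    using fiber by (intro sum.cong) auto
  also have "\<dots> = (\<Sum>k\<le>n. (n choose k) * (?b k * ?a (n - k)))"
    using sum_Pow_card[of ?S "\<lambda>k. ?b k * ?a (n - k)"] by simp
  finally have "root_prob (p ^ r) n = (\<Sum>k\<le>n. real (n choose k) * (?b k * ?a (n - k)) / fact n)"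
    by (simp add: root_prob_def has_mth_root_def has_root_on_def sum_divide_distrib)
  also have "\<dots> = (\<Sum>k\<le>n. singular_ratio p (p ^ r) k * regular_ratio p (n - k))"
    \<comment> \<open>The factorials of the binomial coefficient normalise the two counts, and its
      \<open>fact n\<close> cancels.\<close>
    by (intro sum.cong) (auto simp: binomial_fact singular_ratio_def regular_ratio_def field_simps)
  finally show ?thesis .
qed

text \<open>Only multiples of \<open>p\<close> contribute, and since \<open>i < p\<close> those up
  to \<open>j * p + i\<close> are \<open>0, p, ..., j * p\<close>. Thus \<open>i\<close> survives
  only in the argument of \<open>regular_ratio\<close>.\<close>

lemma root_prob_multiples:
  assumes "prime p" "i < p"
  shows "root_prob (p ^ r) (j * p + i)
    = (\<Sum>k\<le>j. singular_ratio p (p ^ r) (k * p) * regular_ratio p ((j - k) * p + i))"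
proof -
  let ?f = "\<lambda>k. singular_ratio p (p ^ r) k * regular_ratio p (j * p + i - k)"
  have p: "p > 0" using assms by simp
  have "k \<le> j" if "k * p \<le> j * p + i" for k
  proof -
    have "k * p < Suc j * p" using that assms(2) by simp
    thus ?thesis using mult_less_cancel2[of k p "Suc j"] by linarith
  qed
  hence mult: "{k. k \<le> j * p + i \<and> p dvd k} = (\<lambda>k. k * p) ` {..j}"
    by (auto simp: image_iff dvd_def mult.commute intro: trans_le_add1)
  have "root_prob (p ^ r) (j * p + i) = (\<Sum>k\<le>j * p + i. ?f k)"
    by (rule root_prob_convolution[OF assms(1)])
  also have "\<dots> = (\<Sum>k | k \<le> j * p + i \<and> p dvd k. ?f k)"
    by (intro sum.mono_neutral_right) (auto simp: singular_ratio_eq_0)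
  also have "\<dots> = (\<Sum>k\<le>j. ?f (k * p))"
    unfolding mult using p by (subst sum.reindex) (auto simp: inj_on_def)
  also have "\<dots> = (\<Sum>k\<le>j. singular_ratio p (p ^ r) (k * p) * regular_ratio p ((j - k) * p + i))"
    by (intro sum.cong) (simp_all add: diff_mult_distrib)
  finally show ?thesis .
qed

section \<open>Constancy on blocks of length \<open>p\<close>\<close>

lemma root_prob_1: "root_prob 1 n = 1"
proof -
  have "{\<sigma>. \<sigma> permutes {1..n} \<and> has_mth_root 1 n \<sigma>} = {\<sigma>. \<sigma> permutes {1..n}}"
    by (auto simp: has_mth_root_def)
  moreover have "card {\<sigma>. \<sigma> permutes {1..n}} = fact n" by (rule card_permutations) simp_all
  ultimately show ?thesis by (simp add: root_prob_def)
qed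

text \<open>The identity is the only permutation of the empty set and has no singular points. This
  leading coefficient 1 allows the convolution for \<open>m = 1\<close> to be solved for its
  \<open>k = 0\<close> term.\<close>

lemma singular_ratio_0:
  assumes "p \<noteq> 1"
  shows "singular_ratio p 1 0 = 1"
proof -
  have "p_singular p (id :: nat \<Rightarrow> nat) = {}"
    using p_singular_subset[of id "{}"] assms by simp
  hence "singular_rooted p 1 {1..0::nat} = {id}"
    by (auto simp: singular_rooted_def has_root_on_def)
  thus ?thesis by (simp add: singular_ratio_def)
qed

lemma regular_ratio_eq:
  assumes "prime p" "i < p"
  shows "regular_ratio p (j * p + i) = regular_ratio p (j * p)"
proof (induction j rule: less_induct)
  case (less j)
  have p: "0 < p" using assms by simp
  have s0: "singular_ratio p 1 0 = 1" using assms by (intro singular_ratio_0) auto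
  \<comment> \<open>The residue \<open>l\<close> is kept free, to be taken as \<open>i\<close> and
    as \<open>0\<close>. The remaining terms have \<open>k \<ge> 1\<close>, so the induction
    hypothesis covers them.\<close>
  have expand: "regular_ratio p (j * p + l) = 1 -
      (\<Sum>k\<in>{1..j}. singular_ratio p 1 (k * p) * regular_ratio p ((j - k) * p + l))" if "l < p" for l
  proof -
    have "1 = (\<Sum>k\<in>{0..j}. singular_ratio p 1 (k * p) * regular_ratio p ((j - k) * p + l))"
      \<comment> \<open>The exponent \<open>r = 0\<close> gives \<open>m = 1\<close>, where every
        permutation is its own root.\<close>
      using root_prob_multiples[OF assms(1) that, of 0 j] by (simp add: root_prob_1[simplified] atLeast0AtMost)
    also have "\<dots> = regular_ratio p (j * p + l) +
        (\<Sum>k\<in>{1..j}. singular_ratio p 1 (k * p) * regular_ratio p ((j - k) * p + l))"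
      using s0 by (simp add: sum.atLeast_Suc_atMost)
    finally show ?thesis by simp
  qed
  have "(\<Sum>k\<in>{1..j}. singular_ratio p 1 (k * p) * regular_ratio p ((j - k) * p + i))
      = (\<Sum>k\<in>{1..j}. singular_ratio p 1 (k * p) * regular_ratio p ((j - k) * p + 0))"
    using less.IH by (intro sum.cong) auto
  with expand[OF assms(2)] expand[OF p] show ?case by simp
qed

theorem proposition9:
  fixes p r m j :: nat
  assumes "prime p" and "r > 0" and "m = p ^ r"
  shows "\<forall>i<p. root_prob m (j * p + i) = root_prob m (j * p)"
proof (intro allI impI)
  fix i assume i: "i < p"
  \<comment> \<open>Writing the residue \<open>0\<close> explicitly lets both sides expand by the
    same formula; the sums then agree term by term.\<close>
  have "root_prob m (j * p + i) = root_prob m (j * p + 0)"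
    unfolding assms(3) root_prob_multiples[OF assms(1) i]
      root_prob_multiples[OF assms(1) prime_gt_0_nat[OF assms(1)]]
    by (simp add: regular_ratio_eq[OF assms(1) i])
  thus "root_prob m (j * p + i) = root_prob m (j * p)" by simp
qed

end
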